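(* Let $d\ge3$ and let $\mu_1=(\mu_{11},\dots,\mu_{1d})$, $\mu_2=(\mu_{21},\dots,\mu_{2d})$ with $\mu_{ij}\in\mathbb{R}$ be in general position, i.e. $\mu_{1i}-\mu_{2i}\neq\mu_{1j}-\mu_{2j}$ for $1\le i<j\le d$. For $\sigma>0$ consider the random variables $$X_1=(\mu_{11}+\epsilon_{11},\dots,\mu_{1d}+\epsilon_{1d}),\qquad X_2=(\mu_{21}+\epsilon_{21},\dots,\mu_{2d}+\epsilon_{2d}),$$ where the $\epsilon_{ij}$ ($i=1,2$, $j=1,\dots,d$) are independent Gaussian random variables with mean $0$ and standard deviation $\sigma$. Let $X_1'$ (respectively $X_2'$) be the projected point of $X_1$ (respectively $X_2$) onto the one-dimensional Stiefel tropical linear space that passes through $\mu_1$ and $\mu_2$. Then $\mathbb{E}[d_{\rm tr}(X_1,X_1')]\to0$ and $\mathbb{E}[d_{\rm tr}(X_2,X_2')]\to0$ as $\sigma\to0$.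
   Context: ${\bf 1}=(1,\dots,1)$, $[d]=\{1,\dots,d\}$. Tropical distance on $\mathbb{R}^d/\mathbb{R}{\bf 1}$: $d_{\rm tr}(v,w)=\max_i(v_i-w_i)-\min_i(v_i-w_i)$. For a $2\times d$ matrix $A$ over $\mathbb{R}\cup\{-\infty\}$, its Plücker coordinates are $p(\{i,j\})=\max(A_{1i}+A_{2j},A_{1j}+A_{2i})$ for $i\ne j$, and its Stiefel tropical linear space (of dimension one) is the set of $x\in(\mathbb{R}\cup\{-\infty\})^d/\mathbb{R}{\bf 1}$ such that for every triple of distinct $i,j,k$ the maximum of $p(\{j,k\})+x_i,\ p(\{i,k\})+x_j,\ p(\{i,j\})+x_k$ is attained at least twice. For $\mu_1,\mu_2$ in general position the unique such space passing through (i.e. containing) both points is that of the matrix with rows $\mu_1,\mu_2$, so $p(\{i,j\})=\max(\mu_{1i}+\mu_{2j},\mu_{1j}+\mu_{2i})$. The projected point of $u\in\mathbb{R}^d/\mathbb{R}{\bf 1}$ onto it is the point $w$ given by the Blue Rule: $w_i=\max_{\tau\in[d],\,\tau\ne i}\ \min_{j\neq\tau}\{u_j+p(\{\tau,i\})-p(\{\tau,j\})\}$; it is a known fact that $w$ lies in the space and minimizes $d_{\rm tr}(u,\cdot)$ over it. *)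

theory Defs
  imports "HOL-Probability.Probability"
begin

text \<open>
  Points of the tropical projective torus (real vectors modulo the all-ones vector) are
  given by representatives: the tropical distance, membership in a tropical linear space and,
  up to the same translation, the Blue Rule do not depend on the choice.
  The index set \<open>{1..d}\<close> is the finite type \<open>'d\<close>.
\<close>

definition trop_dist :: "real^'d \<Rightarrow> real^'d \<Rightarrow> real" where
  "trop_dist v w = (MAX i. v $ i - w $ i) - (MIN i. v $ i - w $ i)"

definition plucker :: "ereal^'d^2 \<Rightarrow> 'd \<Rightarrow> 'd \<Rightarrow> ereal" where
  "plucker A i j = max (A $ 1 $ i + A $ 2 $ j) (A $ 1 $ j + A $ 2 $ i)"

text \<open>
  Matrices over \<open>\<real> \<union> {-\<infinity>}\<close> whose Pluecker vector is a genuine one, that is, not constantly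
  \<open>-\<infinity>\<close>; otherwise the Pluecker conditions are void and do not cut out a one-dimensional space.
\<close>
definition stiefel_matrix :: "ereal^'d^2 \<Rightarrow> bool" where
  "stiefel_matrix A \<longleftrightarrow>
     (\<forall>r i. A $ r $ i \<noteq> \<infinity>) \<and> (\<exists>i j. i \<noteq> j \<and> plucker A i j \<noteq> -\<infinity>)"

definition max_attained_twice :: "'a::linorder \<Rightarrow> 'a \<Rightarrow> 'a \<Rightarrow> bool" where
  "max_attained_twice a b c \<longleftrightarrow>
     (a = b \<and> c \<le> a) \<or> (a = c \<and> b \<le> a) \<or> (b = c \<and> a \<le> b)"

definition stiefel_space :: "ereal^'d^2 \<Rightarrow> (ereal^'d) set" where
  "stiefel_space A =
     {x. (\<forall>i. x $ i \<noteq> \<infinity>) \<and>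
         (\<forall>i j k. i \<noteq> j \<longrightarrow> i \<noteq> k \<longrightarrow> j \<noteq> k \<longrightarrow>
            max_attained_twice (plucker A j k + x $ i) (plucker A i k + x $ j)
              (plucker A i j + x $ k))}"

definition ereal_vec :: "real^'d \<Rightarrow> ereal^'d" where
  "ereal_vec x = (\<chi> i. ereal (x $ i))"

text \<open>
  The Blue Rule. The conversion back to the reals loses nothing when the Pluecker coordinates
  are finite; by \<open>plucker_unique\<close> below this is so for every space through two real points
  in general position.
\<close>
definition trop_proj :: "ereal^'d^2 \<Rightarrow> real^'d \<Rightarrow> real^'d" where
  "trop_proj A u = (\<chi> i. real_of_ereal
     (MAX \<tau>\<in>{\<tau>. \<tau> \<noteq> i}. MIN j\<in>{j. j \<noteq> \<tau>}.
        ereal (u $ j) + plucker A \<tau> i - plucker A \<tau> j))"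

definition general_position :: "real^'d^2 \<Rightarrow> bool" where
  "general_position \<mu> \<longleftrightarrow>
     (\<forall>i j. i \<noteq> j \<longrightarrow> \<mu> $ 1 $ i - \<mu> $ 2 $ i \<noteq> \<mu> $ 1 $ j - \<mu> $ 2 $ j)"

definition ereal_mat :: "real^'d^2 \<Rightarrow> ereal^'d^2" where
  "ereal_mat \<mu> = (\<chi> r. ereal_vec (\<mu> $ r))"

lemma plucker_ereal_mat:
  "plucker (ereal_mat \<mu>) i j =
     ereal (max (\<mu> $ 1 $ i + \<mu> $ 2 $ j) (\<mu> $ 1 $ j + \<mu> $ 2 $ i))"
  by (simp add: plucker_def ereal_mat_def ereal_vec_def)

lemma plucker_commute: "plucker A i j = plucker A j i"
  by (simp add: plucker_def max.commute)

text \<open>The matrix with rows \<open>\<mu> $ 1\<close> and \<open>\<mu> $ 2\<close> defines a space through these two points.\<close>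
lemma stiefel_space_through:
  fixes \<mu> :: "real^'d^2"
  assumes "CARD('d) \<ge> 2"
  shows "stiefel_matrix (ereal_mat \<mu>)" and "ereal_vec (\<mu> $ r) \<in> stiefel_space (ereal_mat \<mu>)"
proof -
  obtain i j :: 'd where "i \<noteq> j"
    using assms card_2_iff' ex_card[of 2 "UNIV::'d set"] by (metis card_2_iff)
  then show "stiefel_matrix (ereal_mat \<mu>)"
    unfolding stiefel_matrix_def plucker_ereal_mat
    by (simp add: ereal_mat_def ereal_vec_def del: ereal_max) blast
  have "r = 1 \<or> r = 2" by (rule exhaust_2)
  then show "ereal_vec (\<mu> $ r) \<in> stiefel_space (ereal_mat \<mu>)"
    unfolding stiefel_space_def plucker_ereal_mat max_attained_twice_def
    by (auto simp: ereal_vec_def max_def algebra_simps)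
qed

text \<open>Conversely, it is the only such space: Pluecker coordinates are unique up to a constant.\<close>
lemma plucker_unique:
  fixes \<mu> :: "real^'d^2"
  assumes d: "CARD('d) \<ge> 3" and gp: "general_position \<mu>"
    and A: "stiefel_matrix A"
    and mem: "\<And>r. ereal_vec (\<mu> $ r) \<in> stiefel_space A"
  obtains c :: real
    where "\<And>i j. i \<noteq> j \<Longrightarrow> plucker A i j = ereal c + plucker (ereal_mat \<mu>) i j"
proof -
  let ?p = "plucker A"
  have ninf: "?p i j \<noteq> \<infinity>" for i j
    using A by (auto simp: stiefel_matrix_def plucker_def max_def)
  have tw: "max_attained_twice (?p j k + ereal (\<mu> $ r $ i)) (?p i k + ereal (\<mu> $ r $ j))
              (?p i j + ereal (\<mu> $ r $ k))"
    if "i \<noteq> j" "i \<noteq> k" "j \<noteq> k" for i j k r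
    using mem[of r] that by (auto simp: stiefel_space_def ereal_vec_def)
  have gpD: "\<mu> $ 1 $ i - \<mu> $ 2 $ i \<noteq> \<mu> $ 1 $ j - \<mu> $ 2 $ j" if "i \<noteq> j" for i j
    using gp that by (auto simp: general_position_def)
  have fin1: "?p i k \<noteq> -\<infinity>" if "i \<noteq> j" "i \<noteq> k" "j \<noteq> k" "?p i j \<noteq> -\<infinity>" for i j k
  proof
    assume m: "?p i k = -\<infinity>"
    show False
      using tw[of i j k 1] tw[of i j k 2] that m ninf[of i j] ninf[of j k] gpD[of i k]
        gpD[of j k] gpD[of i j]
      by (cases "?p i j"; cases "?p j k") (auto simp: max_attained_twice_def)
  qed
  obtain i0 j0 where ij0: "i0 \<noteq> j0" "?p i0 j0 \<noteq> -\<infinity>"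
    using A by (auto simp: stiefel_matrix_def)
  have a: "?p i0 k \<noteq> -\<infinity>" if "k \<noteq> i0" for k
    using fin1[of i0 j0 k] ij0 that by (cases "k = j0") auto
  have fin: "?p i j \<noteq> -\<infinity>" if "i \<noteq> j" for i j
  proof (cases "i = i0 \<or> j = i0")
    case True
    then show ?thesis using a that plucker_commute by metis
  next
    case False
    then show ?thesis
      using fin1[of i i0 j] a[of i] that plucker_commute by metis
  qed
  define q where "q i j = real_of_ereal (?p i j)" for i j
  define s where "s i j = max (\<mu> $ 1 $ i + \<mu> $ 2 $ j) (\<mu> $ 1 $ j + \<mu> $ 2 $ i)" for i j
  have pq: "?p i j = ereal (q i j)" if "i \<noteq> j" for i j
    using fin[OF that] ninf[of i j] by (cases "?p i j") (auto simp: q_def)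
  have qc: "q i j = q j i" and sc: "s i j = s j i" for i j
    by (simp_all add: q_def s_def plucker_commute max.commute)
  have step: "q i j - s i j = q i k - s i k" if "i \<noteq> j" "i \<noteq> k" "j \<noteq> k" for i j k
    using tw[OF that, of 1] tw[OF that, of 2] gpD[OF that(1)] gpD[OF that(2)] gpD[OF that(3)]
    unfolding pq[OF that(1)] pq[OF that(2)] pq[OF that(3)] max_attained_twice_def s_def
    by (simp add: max_def) argo
  have b: "q i0 k - s i0 k = q i0 j0 - s i0 j0" if "k \<noteq> i0" for k
    using step[of i0 j0 k] ij0 that by (cases "k = j0") auto
  have "q i j - s i j = q i0 j0 - s i0 j0" if "i \<noteq> j" for i j
  proof (cases "i = i0 \<or> j = i0")
    case True
    then show ?thesis using b that qc sc by metis
  next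
    case False
    then show ?thesis
      using step[of i i0 j] b[of i] that qc sc by metis
  qed
  then have "?p i j = ereal (q i0 j0 - s i0 j0) + plucker (ereal_mat \<mu>) i j" if "i \<noteq> j" for i j
    unfolding pq[OF that] plucker_ereal_mat s_def[symmetric] using that
    by (simp add: s_def[symmetric]) (smt (verit, best))
  then show ?thesis by (rule that)
qed

end

theory Submission
  imports Defs
begin

text \<open>
  The Blue Rule moves no coordinate up, and it moves none down by much when the given point
  \<open>u\<close> is near \<open>\<mu> $ r\<close>. The first half is immediate: the entry \<open>j = i\<close> of every
  minimum is \<open>u $ i\<close> itself. For the second half it suffices to find, for each coordinate \<open>i\<close>, one
  \<open>\<tau> \<noteq> i\<close> for which \<open>j = i\<close> attains the minimum at the point \<open>\<mu> $ r\<close>: if no coordinate of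
  \<open>u\<close> differs from that of \<open>\<mu> $ r\<close> by more than \<open>e\<close>, this \<open>\<tau>\<close> alone keeps coordinate \<open>i\<close>
  above \<open>\<mu> $ r $ i - e \<ge> u $ i - 2 * e\<close>. Such a \<open>\<tau>\<close> exists by
  \<open>exists_blue_rule_witness\<close>, where the difference of the two rows of \<open>\<mu>\<close> decides the choice.
  So the tropical distance from \<open>u\<close> to its projection is at most \<open>2 * e\<close>
  (\<open>trop_dist_trop_proj_le\<close>).

  Taking for \<open>e\<close> the sum of the absolute errors turns this into a pointwise bound that is
  integrable, and whose expectation is a constant times \<open>\<sigma>\<close>, since a centred Gaussian
  of standard deviation \<open>\<sigma>\<close> has mean absolute value \<open>\<sigma> * sqrt (2 / pi)\<close>.

  The space is only known to pass through both points, but \<open>plucker_unique\<close> fixes its Pluecker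
  coordinates up to an additive constant, which cancels in the Blue Rule.
\<close>

section \<open>The Blue Rule in real arithmetic\<close>

definition real_plucker :: "real^'d \<Rightarrow> real^'d \<Rightarrow> 'd \<Rightarrow> 'd \<Rightarrow> real" where
  "real_plucker a b i j = max (a $ i + b $ j) (a $ j + b $ i)"

lemma real_plucker_swap: "real_plucker a b = real_plucker b a"
  by (intro ext) (simp add: real_plucker_def max.commute add.commute)

lemma ex_neq_of_card_ge_2:
  assumes "CARD('d::finite) \<ge> 2"
  shows "\<exists>\<tau>::'d. \<tau> \<noteq> i"
proof (rule ccontr)
  assume "\<not> ?thesis"
  then have "(UNIV :: 'd set) = {i}" by auto
  then have "CARD('d) = card {i}" by (rule arg_cong)
  then show False using assms by simp
qed

lemma real_of_ereal_MAX_MIN: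
  fixes f :: "'a \<Rightarrow> 'b \<Rightarrow> real"
  assumes "finite S" "S \<noteq> {}" "\<And>s. s \<in> S \<Longrightarrow> finite (T s) \<and> T s \<noteq> {}"
  shows "real_of_ereal (MAX s\<in>S. MIN t\<in>T s. ereal (f s t)) = (MAX s\<in>S. MIN t\<in>T s. f s t)"
proof -
  have mono: "mono ereal" by (auto intro: monoI)
  have "(MIN t\<in>T s. ereal (f s t)) = ereal (MIN t\<in>T s. f s t)" if "s \<in> S" for s
    using mono_Min_commute[OF mono, of "f s ` T s"] assms(3)[OF that] by (simp add: image_image)
  then have "(MAX s\<in>S. MIN t\<in>T s. ereal (f s t)) = (MAX s\<in>S. ereal (MIN t\<in>T s. f s t))"
    by simp
  also have "\<dots> = ereal (MAX s\<in>S. MIN t\<in>T s. f s t)"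
    using mono_Max_commute[OF mono, of "(\<lambda>s. MIN t\<in>T s. f s t) ` S"] assms(1,2)
    by (simp add: image_image)
  finally show ?thesis by simp
qed

text \<open>
  Off the diagonal the Pluecker coordinates of the space are those of \<open>\<mu>\<close> plus a constant, and the
  Blue Rule uses only differences of off-diagonal ones.
\<close>
lemma trop_proj_through_points:
  fixes \<mu> :: "real^'d^2"
  assumes "CARD('d) \<ge> 3" "general_position \<mu>" "stiefel_matrix A"
    and "\<And>r. ereal_vec (\<mu> $ r) \<in> stiefel_space A"
  shows "trop_proj A u $ i =
    (MAX \<tau>\<in>{\<tau>. \<tau> \<noteq> i}. MIN j\<in>{j. j \<noteq> \<tau>}.
       u $ j + real_plucker (\<mu> $ 1) (\<mu> $ 2) \<tau> i - real_plucker (\<mu> $ 1) (\<mu> $ 2) \<tau> j)"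
proof -
  obtain c where c: "plucker A k l = ereal (c + real_plucker (\<mu> $ 1) (\<mu> $ 2) k l)"
    if "k \<noteq> l" for k l
    using plucker_unique[OF assms]
    unfolding plucker_ereal_mat real_plucker_def plus_ereal.simps by metis
  have ne: "\<exists>\<tau>::'d. \<tau> \<noteq> k" for k
    using assms(1) by (intro ex_neq_of_card_ge_2) simp
  have "(MAX \<tau>\<in>{\<tau>. \<tau> \<noteq> i}. MIN j\<in>{j. j \<noteq> \<tau>}.
      ereal (u $ j) + plucker A \<tau> i - plucker A \<tau> j) =
    (MAX \<tau>\<in>{\<tau>. \<tau> \<noteq> i}. MIN j\<in>{j. j \<noteq> \<tau>}.
      ereal (u $ j + real_plucker (\<mu> $ 1) (\<mu> $ 2) \<tau> i - real_plucker (\<mu> $ 1) (\<mu> $ 2) \<tau> j))"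
    by (intro arg_cong[where f = Max] arg_cong[where f = Min] image_cong refl)
       (auto simp: c)
  then show ?thesis
    unfolding trop_proj_def using ne by (simp add: real_of_ereal_MAX_MIN)
qed

section \<open>The projection stays close to the point\<close>

text \<open>
  Write \<open>\<delta> k = a $ k - b $ k\<close>. Then \<open>a $ k - real_plucker a b \<tau> k\<close> equals
  \<open>min (\<delta> k - \<delta> \<tau>) 0 - b $ \<tau>\<close>. This is nondecreasing in \<open>\<delta> k\<close>, so any
  \<open>\<tau> \<noteq> i\<close> will do if \<open>i\<close> minimizes \<open>\<delta>\<close>; and a minimizer \<open>\<tau>\<close> of \<open>\<delta>\<close> makes it constant in \<open>k\<close>.
\<close>
lemma exists_blue_rule_witness:
  fixes a b :: "real^'d"
  assumes "CARD('d) \<ge> 2"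
  shows "\<exists>\<tau>. \<tau> \<noteq> i \<and> (\<forall>j. a $ i - real_plucker a b \<tau> i \<le> a $ j - real_plucker a b \<tau> j)"
proof -
  define \<delta> where "\<delta> k = a $ k - b $ k" for k
  have split: "a $ k - real_plucker a b \<tau> k = min (\<delta> k - \<delta> \<tau>) 0 - b $ \<tau>" for k \<tau>
    by (simp add: real_plucker_def \<delta>_def min_def max_def)
  have "Min (range \<delta>) \<in> range \<delta>" by (rule Min_in) auto
  then obtain m where "\<delta> m = Min (range \<delta>)" by (metis imageE)
  then have m: "\<delta> m \<le> \<delta> k" for k by simp
  show ?thesis
  proof (cases "i = m")
    case True
    moreover obtain \<tau> where "\<tau> \<noteq> i" using ex_neq_of_card_ge_2[OF assms] by blast
    ultimately show ?thesis
      using m unfolding split by (intro exI[of _ \<tau>]) (auto simp: min_def intro: order_trans)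
  next
    case False
    then show ?thesis using m unfolding split by (intro exI[of _ m]) (simp add: min_absorb2)
  qed
qed

lemma trop_dist_le:
  assumes "\<And>i. 0 \<le> v $ i - w $ i" "\<And>i. v $ i - w $ i \<le> b"
  shows "trop_dist v w \<le> b"
proof -
  have "(MAX i. v $ i - w $ i) \<le> b" using assms(2) by (intro Max.boundedI) auto
  moreover have "0 \<le> (MIN i. v $ i - w $ i)" using assms(1) by (intro Min.boundedI) auto
  ultimately show ?thesis unfolding trop_dist_def by linarith
qed

lemma trop_dist_nonneg: "0 \<le> trop_dist v w"
proof -
  fix i
  have "(MIN i. v $ i - w $ i) \<le> v $ i - w $ i" by (rule Min_le) auto
  also have "\<dots> \<le> (MAX i. v $ i - w $ i)" by (rule Max_ge) auto
  finally show ?thesis by (simp add: trop_dist_def)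
qed

lemma trop_dist_trop_proj_le:
  fixes \<mu> :: "real^'d^2"
  assumes card: "CARD('d) \<ge> 3" and A: "general_position \<mu>" "stiefel_matrix A"
    "\<And>r. ereal_vec (\<mu> $ r) \<in> stiefel_space A"
    and close: "\<And>j. \<bar>u $ j - \<mu> $ r $ j\<bar> \<le> e"
  shows "trop_dist u (trop_proj A u) \<le> 2 * e"
proof (rule trop_dist_le)
  fix i
  define p where "p = real_plucker (\<mu> $ 1) (\<mu> $ 2)"
  define g where "g \<tau> = (MIN j\<in>{j. j \<noteq> \<tau>}. u $ j + p \<tau> i - p \<tau> j)" for \<tau>
  have proj: "trop_proj A u $ i = (MAX \<tau>\<in>{\<tau>. \<tau> \<noteq> i}. g \<tau>)"
    unfolding g_def p_def by (rule trop_proj_through_points[OF card A])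
  obtain \<tau> where \<tau>: "\<tau> \<noteq> i" and best: "\<And>j. \<mu> $ r $ i - p \<tau> i \<le> \<mu> $ r $ j - p \<tau> j"
  proof (cases "r = 1")
    case True
    then show ?thesis
      using exists_blue_rule_witness[of i "\<mu> $ 1" "\<mu> $ 2"] card that unfolding p_def by auto
  next
    case False
    then have "r = 2" using exhaust_2 by blast
    then show ?thesis
      using exists_blue_rule_witness[of i "\<mu> $ 2" "\<mu> $ 1"] card that
      unfolding p_def real_plucker_swap[of "\<mu> $ 1"] by auto
  qed
  have "g t \<le> u $ i" if "t \<noteq> i" for t
    unfolding g_def using that by (intro Min_le) (auto intro!: image_eqI[of _ _ i])
  then have "trop_proj A u $ i \<le> u $ i"
    unfolding proj using \<tau> by (intro Max.boundedI) auto
  then show "0 \<le> u $ i - trop_proj A u $ i" by simp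
  have "\<mu> $ r $ i - e \<le> g \<tau>"
    unfolding g_def
  proof (rule Min.boundedI)
    fix x assume "x \<in> (\<lambda>j. u $ j + p \<tau> i - p \<tau> j) ` {j. j \<noteq> \<tau>}"
    then obtain j where "x = u $ j + p \<tau> i - p \<tau> j" by auto
    then show "\<mu> $ r $ i - e \<le> x" using best[of j] close[of j] by linarith
  qed (use \<tau> in auto)
  also have "\<dots> \<le> trop_proj A u $ i"
    unfolding proj using \<tau> by (intro Max_ge) auto
  finally show "u $ i - trop_proj A u $ i \<le> 2 * e" using close[of i] by linarith
qed

section \<open>Gaussian errors\<close>

lemma borel_measurable_trop_dist_trop_proj:
  fixes \<mu> :: "real^'d^2"
  assumes "CARD('d) \<ge> 3" "general_position \<mu>" "stiefel_matrix A"
    "\<And>r. ereal_vec (\<mu> $ r) \<in> stiefel_space A"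
    and [measurable]: "\<And>j. (\<lambda>\<omega>. Y \<omega> $ j) \<in> borel_measurable N"
  shows "(\<lambda>\<omega>. trop_dist (Y \<omega>) (trop_proj A (Y \<omega>))) \<in> borel_measurable N"
  unfolding trop_dist_def trop_proj_through_points[OF assms(1-4)]
  by (intro borel_measurable_diff borel_measurable_Max borel_measurable_Min) auto

lemma centred_normal_abs:
  fixes Y :: "'a \<Rightarrow> real"
  assumes "\<sigma> > 0" and Y: "distributed N lborel Y (normal_density 0 \<sigma>)"
  shows "integrable N (\<lambda>\<omega>. \<bar>Y \<omega>\<bar>)" and "(\<integral>\<omega>. \<bar>Y \<omega>\<bar> \<partial>N) = \<sigma> * sqrt (2 / pi)"
proof -
  have "has_bochner_integral lborel (\<lambda>x. normal_density 0 \<sigma> x * \<bar>x\<bar>) (\<sigma> * sqrt (2 / pi))"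
    using normal_moment_abs_odd[of \<sigma> 0 0] assms(1) by simp
  moreover have "integrable lborel (\<lambda>x. normal_density 0 \<sigma> x * \<bar>x\<bar>) =
      integrable N (\<lambda>\<omega>. \<bar>Y \<omega>\<bar>)"
    by (rule distributed_integrable[OF Y]) auto
  moreover have "(\<integral>x. normal_density 0 \<sigma> x * \<bar>x\<bar> \<partial>lborel) = (\<integral>\<omega>. \<bar>Y \<omega>\<bar> \<partial>N)"
    by (rule distributed_integral[OF Y]) auto
  ultimately show "integrable N (\<lambda>\<omega>. \<bar>Y \<omega>\<bar>)" "(\<integral>\<omega>. \<bar>Y \<omega>\<bar> \<partial>N) = \<sigma> * sqrt (2 / pi)"
    by (auto simp: has_bochner_integral_iff)
qed

theorem theorem22:
  fixes \<mu> :: "real^'d^2"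
    and A :: "ereal^'d^2"
    and M :: "real \<Rightarrow> 'a measure"
    and \<epsilon> :: "real \<Rightarrow> 2 \<Rightarrow> 'd \<Rightarrow> 'a \<Rightarrow> real"
    and X :: "real \<Rightarrow> 2 \<Rightarrow> 'a \<Rightarrow> real^'d"
  assumes "CARD('d) \<ge> 3"
    and "general_position \<mu>"
    and "stiefel_matrix A"
    and "ereal_vec (\<mu> $ 1) \<in> stiefel_space A"
    and "ereal_vec (\<mu> $ 2) \<in> stiefel_space A"
    and "\<And>\<sigma>. \<sigma> > 0 \<Longrightarrow> prob_space (M \<sigma>)"
    and "\<And>\<sigma>. \<sigma> > 0 \<Longrightarrow>
           prob_space.indep_vars (M \<sigma>) (\<lambda>_. borel) (\<lambda>(i, j). \<epsilon> \<sigma> i j) UNIV"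
    and "\<And>\<sigma> i j. \<sigma> > 0 \<Longrightarrow> distributed (M \<sigma>) lborel (\<epsilon> \<sigma> i j) (normal_density 0 \<sigma>)"
    and "\<And>\<sigma> i \<omega>. X \<sigma> i \<omega> = (\<chi> j. \<mu> $ i $ j + \<epsilon> \<sigma> i j \<omega>)"
  shows "\<forall>i. (\<forall>\<sigma>>0. integrable (M \<sigma>) (\<lambda>\<omega>. trop_dist (X \<sigma> i \<omega>) (trop_proj A (X \<sigma> i \<omega>)))) \<and>
             ((\<lambda>\<sigma>. \<integral>\<omega>. trop_dist (X \<sigma> i \<omega>) (trop_proj A (X \<sigma> i \<omega>)) \<partial>M \<sigma>) \<longlongrightarrow> 0)
               (at_right 0)"
proof
  fix i
  have mem: "ereal_vec (\<mu> $ r) \<in> stiefel_space A" for r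
    using exhaust_2[of r] assms(4,5) by auto
  let ?D = "\<lambda>\<sigma> \<omega>. trop_dist (X \<sigma> i \<omega>) (trop_proj A (X \<sigma> i \<omega>))"
  let ?B = "\<lambda>\<sigma> \<omega>. 2 * (\<Sum>j\<in>UNIV. \<bar>\<epsilon> \<sigma> i j \<omega>\<bar>)"
  have bound: "?D \<sigma> \<omega> \<le> ?B \<sigma> \<omega>" for \<sigma> \<omega>
    using assms(9) by (intro trop_dist_trop_proj_le[OF assms(1-3) mem, where r = i])
      (auto intro: member_le_sum)
  have B_int: "integrable (M \<sigma>) (?B \<sigma>)" if "\<sigma> > 0" for \<sigma>
    using centred_normal_abs(1)[OF that assms(8)[OF that]] by auto
  have B_mean: "(\<integral>\<omega>. ?B \<sigma> \<omega> \<partial>M \<sigma>) = 2 * (CARD('d) * (\<sigma> * sqrt (2 / pi)))" if "\<sigma> > 0" for \<sigma>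
    using centred_normal_abs[OF that assms(8)[OF that]] by (simp add: Bochner_Integration.integral_sum)
  have D_int: "integrable (M \<sigma>) (?D \<sigma>)" if "\<sigma> > 0" for \<sigma>
  proof (rule Bochner_Integration.integrable_bound[OF B_int[OF that]])
    have "\<epsilon> \<sigma> i j \<in> borel_measurable (M \<sigma>)" for j
      using distributed_measurable[OF assms(8)[OF that]] by simp
    then show "?D \<sigma> \<in> borel_measurable (M \<sigma>)"
      by (intro borel_measurable_trop_dist_trop_proj[OF assms(1-3) mem]) (simp add: assms(9))
    show "AE \<omega> in M \<sigma>. norm (?D \<sigma> \<omega>) \<le> norm (?B \<sigma> \<omega>)"
      using bound order_trans[OF bound abs_ge_self]
      by (intro AE_I2) (simp only: real_norm_def abs_of_nonneg[OF trop_dist_nonneg])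
  qed
  have "((\<lambda>\<sigma>. \<integral>\<omega>. ?D \<sigma> \<omega> \<partial>M \<sigma>) \<longlongrightarrow> 0) (at_right 0)"
  proof (rule tendsto_sandwich)
    show "eventually (\<lambda>\<sigma>. 0 \<le> (\<integral>\<omega>. ?D \<sigma> \<omega> \<partial>M \<sigma>)) (at_right 0)"
      by (simp add: trop_dist_nonneg)
    have "(\<integral>\<omega>. ?D \<sigma> \<omega> \<partial>M \<sigma>) \<le> 2 * (CARD('d) * (\<sigma> * sqrt (2 / pi)))" if "\<sigma> > 0" for \<sigma>
      using integral_mono[OF D_int[OF that] B_int[OF that] bound] unfolding B_mean[OF that] .
    then show "eventually (\<lambda>\<sigma>. (\<integral>\<omega>. ?D \<sigma> \<omega> \<partial>M \<sigma>) \<le> 2 * (CARD('d) * (\<sigma> * sqrt (2 / pi))))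
        (at_right 0)"
      using eventually_at_right_less[of 0] by (rule eventually_mono[rotated])
    show "((\<lambda>\<sigma>. 2 * (CARD('d) * (\<sigma> * sqrt (2 / pi)))) \<longlongrightarrow> 0) (at_right 0)"
      by (auto intro!: tendsto_eq_intros)
  qed simp
  then show "(\<forall>\<sigma>>0. integrable (M \<sigma>) (?D \<sigma>)) \<and>
      ((\<lambda>\<sigma>. \<integral>\<omega>. ?D \<sigma> \<omega> \<partial>M \<sigma>) \<longlongrightarrow> 0) (at_right 0)"
    using D_int by blast
qed

end
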